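(* Let $0<\alpha<1$ be a real constant. For each natural number $n$ let $F_n\subseteq\{0,1\}^n$ be a set of binary strings of length $n$ with $\#F_n\le 2^{\alpha n}$. Then there exist an infinite binary sequence $\omega=\omega_0\omega_1\omega_2\ldots$ and a constant $N$ such that for every $n>N$ the sequence $\omega$ does not have a substring $x$ of length $n$ that belongs to $F_n$.
   Context: A substring of length $n$ of an infinite sequence $\omega=\omega_0\omega_1\omega_2\ldots$ is a string of $n$ consecutive terms $\omega_m\omega_{m+1}\ldots\omega_{m+n-1}$ for some $m\ge 0$. *)

theory Defs
  imports Complex_Main
begin

(* Bits are booleans (False for 0, True for 1); an infinite sequence is a function on nat,
   so map w [m..<m + length x] is the string w m, ..., w (m + length x - 1). *)
definition substring :: "'a list \<Rightarrow> (nat \<Rightarrow> 'a) \<Rightarrow> bool" where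
  "substring x w \<longleftrightarrow> (\<exists>m. x = map w [m..<m + length x])"

end

(* If the numbers s k of forbidden words of length k are small enough, the number a n of words of
   length n avoiding all of them grows by a factor of at least \<beta> at each step: of the c * a n
   one-letter extensions of avoiding words over a c-letter alphabet, at most
   (\<Sum>k. a (n + 1 - k) * s k) end in a forbidden word, and by induction a (n + 1 - k) is at most
   a n / \<beta> ^ (k - 1). The choice 2 powr \<alpha> < \<beta> < 2 works once the short forbidden words are
   dropped, since the tail of a geometric series is small. Compactness turns arbitrarily long
   avoiding words into an infinite one. *)
theory Submission
  imports Defs "HOL-Library.Cardinality" "HOL-Library.Sublist"
begin

definition avoiding :: "'a list set \<Rightarrow> nat \<Rightarrow> 'a list set" where
  "avoiding S n = {w. length w = n \<and> (\<forall>x\<in>S. \<not> sublist x w)}"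

lemma finite_avoiding: "finite (avoiding (S :: 'a::finite list set) n)"
proof (rule finite_subset)
  show "avoiding S n \<subseteq> {w. set w \<subseteq> UNIV \<and> length w = n}"
    by (auto simp: avoiding_def)
  show "finite {w :: 'a list. set w \<subseteq> UNIV \<and> length w = n}"
    by (rule finite_lists_length_eq) simp
qed

lemma avoiding_prefix:
  assumes "u @ v \<in> avoiding S n"
  shows "u \<in> avoiding S (length u)"
proof -
  have "sublist u (u @ v)"
    by (simp add: prefix_imp_sublist)
  with assms show ?thesis
    unfolding avoiding_def using sublist_order.order.trans by blast
qed

text \<open>Koenig's lemma for the tree of words over a finite alphabet: a node with descendants at
  every depth has a child with the same property, so an infinite branch can be followed from the
  root.\<close>

lemma koenig_words:
  fixes T :: "'a::finite list set"
  assumes prefix_closed: "\<And>u v. u @ v \<in> T \<Longrightarrow> u \<in> T"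
    and long: "\<And>n. \<exists>w\<in>T. length w = n"
  shows "\<exists>\<omega>. \<forall>n. map \<omega> [0..<n] \<in> T"
proof -
  define P where "P w \<longleftrightarrow> (\<forall>m. \<exists>v. length v = m \<and> w @ v \<in> T)" for w
  have P_Nil: "P []"
    using long by (auto simp: P_def)
  have P_step: "\<exists>b. P (w @ [b])" if P_w: "P w" for w
  proof (rule ccontr)
    assume "\<nexists>b. P (w @ [b])"
    then have "\<forall>b. \<exists>m. \<forall>v. length v = m \<longrightarrow> (w @ [b]) @ v \<notin> T"
      by (auto simp: P_def)
    then obtain m where m: "\<And>b v. length v = m b \<Longrightarrow> (w @ [b]) @ v \<notin> T"
      by metis
    \<comment> \<open>Each letter \<open>b\<close> fails at its own length \<open>m b\<close>. The
      alphabet is finite, so one extension of \<open>w\<close> by \<open>Suc M\<close> letters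
      outlasts all these lengths; cutting it back to \<open>m b\<close> letters after its first
      letter \<open>b\<close> contradicts the choice of \<open>m b\<close>.\<close>
    define M where "M = Max (range m)"
    have le: "m b \<le> M" for b
      by (simp add: M_def)
    obtain u where u: "length u = Suc M" "w @ u \<in> T"
      using P_w unfolding P_def by blast
    then obtain b v where bv: "u = b # v" "length v = M"
      by (auto simp: length_Suc_conv)
    have "((w @ [b]) @ take (m b) v) @ drop (m b) v \<in> T"
      using u bv by simp
    then have "(w @ [b]) @ take (m b) v \<in> T"
      by (rule prefix_closed)
    with m[of "take (m b) v" b] le[of b] bv show False
      by simp
  qed
  have "\<exists>f. \<forall>n. P (f n) \<and> length (f n) = n \<and> (\<exists>b. f (Suc n) = f n @ [b])"
    using dependent_nat_choice[of "\<lambda>n w. P w \<and> length w = n" "\<lambda>n w w'. \<exists>b. w' = w @ [b]"]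
      P_Nil P_step by force
  then obtain f where f: "\<And>n. P (f n)" "\<And>n. length (f n) = n"
    "\<And>n. \<exists>b. f (Suc n) = f n @ [b]"
    by blast
  \<comment> \<open>The words \<open>f n\<close> are nested, so their last letters spell out the
    branch.\<close>
  have "map (\<lambda>n. last (f (Suc n))) [0..<n] = f n" for n
  proof (induction n)
    case 0
    show ?case using f(2)[of 0] by simp
  next
    case (Suc n)
    then show ?case using f(3)[of n] by auto
  qed
  moreover have "f n \<in> T" for n
    using f(1)[of n] prefix_closed by (auto simp: P_def)
  ultimately show ?thesis
    by metis
qed

text \<open>If a one-letter extension of an avoiding word fails to avoid \<open>S\<close>, the
  forbidden word must use the new letter and so is a suffix. Cutting it off leaves a shorter
  avoiding word, and these two pieces determine the extension.\<close>

lemma card_avoiding_extensions: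
  fixes S :: "'a::finite list set"
  assumes "[] \<notin> S"
  shows "CARD('a) * card (avoiding S n) \<le> card (avoiding S (Suc n)) +
    (\<Sum>k=1..Suc n. card (avoiding S (Suc n - k)) * card {x\<in>S. length x = k})"
proof -
  define s where "s k = {x\<in>S. length x = k}" for k
  \<comment> \<open>\<open>B k\<close> may also contain words that do not extend an avoiding word;
    an upper bound on the failures suffices.\<close>
  define B where "B k = (\<lambda>(u, x). u @ x) ` (avoiding S (Suc n - k) \<times> s k)" for k
  have fin_s: "finite (s k)" for k
    by (rule finite_subset[OF _ finite_lists_length_eq[of "UNIV :: 'a set" k]])
      (auto simp: s_def)
  have fin_B: "finite (B k)" for k
    by (simp add: B_def finite_avoiding fin_s)
  have card_B: "card (B k) \<le> card (avoiding S (Suc n - k)) * card (s k)" for k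
    unfolding B_def
    by (metis card_image_le card_cartesian_product finite_avoiding fin_s finite_cartesian_product)
  define E where "E = (\<lambda>(w, b). w @ [b]) ` (avoiding S n \<times> (UNIV :: 'a set))"
  have "inj_on (\<lambda>(w, b). w @ [b]) (avoiding S n \<times> (UNIV :: 'a set))"
    by (auto simp: inj_on_def)
  then have card_E: "card E = CARD('a) * card (avoiding S n)"
    by (simp add: E_def card_image card_cartesian_product mult.commute)
  have "E \<subseteq> avoiding S (Suc n) \<union> (\<Union>k\<in>{1..Suc n}. B k)"
  proof
    fix y assume "y \<in> E"
    then obtain w b where y: "y = w @ [b]" and w: "w \<in> avoiding S n"
      by (auto simp: E_def)
    show "y \<in> avoiding S (Suc n) \<union> (\<Union>k\<in>{1..Suc n}. B k)"
    proof (cases "y \<in> avoiding S (Suc n)")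
      case False
      then obtain x where x: "x \<in> S" "sublist x (w @ [b])"
        using w y by (auto simp: avoiding_def)
      have "suffix x (w @ [b])"
        using x w by (auto simp: avoiding_def sublist_snoc)
      then obtain u where u: "w @ [b] = u @ x"
        by (auto simp: suffix_def)
      \<comment> \<open>Since \<open>x\<close> takes up at least the letter \<open>b\<close>, the
        rest \<open>u\<close> is a prefix of \<open>w\<close> itself and inherits avoidance.\<close>
      have "x \<noteq> []"
        using x assms by auto
      then obtain x' c where "x = x' @ [c]"
        by (metis rev_exhaust)
      with u have "w = u @ x'"
        by simp
      with w have "u \<in> avoiding S (length u)"
        using avoiding_prefix by blast
      moreover have "length u + length x = Suc n"
        using w arg_cong[OF u, of length] by (simp add: avoiding_def)
      then have "length u = Suc n - length x" "length x \<in> {1..Suc n}"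
        using \<open>x \<noteq> []\<close> by (auto simp: Suc_le_eq)
      ultimately have "y \<in> B (length x)"
        using u x y by (auto simp: B_def s_def)
      with \<open>length x \<in> {1..Suc n}\<close> show ?thesis
        by blast
    qed simp
  qed
  then have "card E \<le> card (avoiding S (Suc n) \<union> (\<Union>k\<in>{1..Suc n}. B k))"
    by (intro card_mono) (auto simp: finite_avoiding fin_B)
  also have "\<dots> \<le> card (avoiding S (Suc n)) + card (\<Union>k\<in>{1..Suc n}. B k)"
    by (rule card_Un_le)
  also have "\<dots> \<le> card (avoiding S (Suc n)) + (\<Sum>k=1..Suc n. card (B k))"
    by (intro add_left_mono card_UN_le) simp
  also have "\<dots> \<le> card (avoiding S (Suc n)) +
      (\<Sum>k=1..Suc n. card (avoiding S (Suc n - k)) * card (s k))"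
    by (intro add_left_mono sum_mono card_B)
  finally show ?thesis
    by (simp add: card_E s_def)
qed

text \<open>The exponent \<open>k - 1\<close> counts the steps from length \<open>Suc n - k\<close>
  up to length \<open>n\<close>. All earlier growth steps are needed at once, hence the strong
  induction.\<close>

lemma card_avoiding_growth:
  fixes S :: "'a::finite list set" and \<beta> :: real
  assumes "[] \<notin> S" and "\<beta> > 0"
    and small: "\<And>n. (\<Sum>k=1..n. real (card {x\<in>S. length x = k}) / \<beta> ^ (k - 1)) \<le> CARD('a) - \<beta>"
  shows "\<beta> * card (avoiding S n) \<le> card (avoiding S (Suc n))"
proof (induction n rule: less_induct)
  case (less n)
  define a where "a j = real (card (avoiding S j))" for j
  define s where "s k = real (card {x\<in>S. length x = k})" for k
  have step: "\<beta> * a j \<le> a (Suc j)" if "j < n" for j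
    using less[OF that] by (simp add: a_def)
  have iter: "\<beta> ^ i * a (n - i) \<le> a n" if "i \<le> n" for i
    using that
  proof (induction i)
    case (Suc i)
    have "\<beta> * a (n - Suc i) \<le> a (Suc (n - Suc i))"
      by (rule step) (use Suc.prems in simp)
    also have "Suc (n - Suc i) = n - i"
      using Suc.prems by simp
    finally have "\<beta> ^ i * (\<beta> * a (n - Suc i)) \<le> \<beta> ^ i * a (n - i)"
      using \<open>\<beta> > 0\<close> by (intro mult_left_mono) auto
    with Suc show ?case
      by (simp add: algebra_simps)
  qed simp
  have "real (CARD('a) * card (avoiding S n)) \<le> real (card (avoiding S (Suc n)) +
      (\<Sum>k=1..Suc n. card (avoiding S (Suc n - k)) * card {x\<in>S. length x = k}))"
    using card_avoiding_extensions[OF assms(1), of n] by (simp only: of_nat_le_iff)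
  then have "CARD('a) * a n \<le> a (Suc n) + (\<Sum>k=1..Suc n. a (Suc n - k) * s k)"
    by (simp only: of_nat_add of_nat_mult of_nat_sum a_def s_def)
  also have "(\<Sum>k=1..Suc n. a (Suc n - k) * s k) \<le> (\<Sum>k=1..Suc n. a n * (s k / \<beta> ^ (k - 1)))"
  proof (rule sum_mono)
    fix k assume k: "k \<in> {1..Suc n}"
    have "\<beta> ^ (k - 1) * a (n - (k - 1)) \<le> a n"
      by (rule iter) (use k in auto)
    also have "n - (k - 1) = Suc n - k"
      using k by auto
    finally have "a (Suc n - k) \<le> a n / \<beta> ^ (k - 1)"
      using \<open>\<beta> > 0\<close> by (simp add: field_simps)
    then have "a (Suc n - k) * s k \<le> a n / \<beta> ^ (k - 1) * s k"
      by (rule mult_right_mono) (simp add: s_def)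
    then show "a (Suc n - k) * s k \<le> a n * (s k / \<beta> ^ (k - 1))"
      by simp
  qed
  also have "\<dots> = a n * (\<Sum>k=1..Suc n. s k / \<beta> ^ (k - 1))"
    by (rule sum_distrib_left[symmetric])
  also have "\<dots> \<le> a n * (CARD('a) - \<beta>)"
    by (rule mult_left_mono) (use small[of "Suc n"] in \<open>simp_all only: s_def a_def of_nat_0_le_iff\<close>)
  finally have "\<beta> * a n \<le> a (Suc n)"
    by (simp add: algebra_simps)
  then show ?case
    by (simp add: a_def)
qed

text \<open>Starting from the single empty word, growth by a positive factor keeps every count
  positive, so avoiding words of all lengths exist. A forbidden word occurring in the limit sequence
  would already lie in a finite prefix.\<close>

lemma ex_sequence_avoiding:
  fixes S :: "'a::finite list set" and \<beta> :: real
  assumes "[] \<notin> S" and "\<beta> > 0"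
    and "\<And>n. (\<Sum>k=1..n. real (card {x\<in>S. length x = k}) / \<beta> ^ (k - 1)) \<le> CARD('a) - \<beta>"
  shows "\<exists>\<omega>. \<forall>x\<in>S. \<not> substring x \<omega>"
proof -
  have pos: "card (avoiding S n) > 0" for n
  proof (induction n)
    case 0
    have "avoiding S 0 = {[]}"
      using assms(1) by (auto simp: avoiding_def)
    then show ?case by simp
  next
    case (Suc n)
    then have "0 < \<beta> * card (avoiding S n)"
      using assms(2) by simp
    also have "\<dots> \<le> card (avoiding S (Suc n))"
      by (rule card_avoiding_growth[OF assms])
    finally show ?case by simp
  qed
  have "\<exists>\<omega>. \<forall>n. map \<omega> [0..<n] \<in> (\<Union>n. avoiding S n)"
  proof (rule koenig_words)
    show "\<exists>w\<in>\<Union>n. avoiding S n. length w = n" for n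
      using pos[of n] by (force simp: card_gt_0_iff avoiding_def)
  qed (use avoiding_prefix in blast)
  then obtain \<omega> where \<omega>: "\<And>n. map \<omega> [0..<n] \<in> (\<Union>n. avoiding S n)"
    by blast
  have "\<not> substring x \<omega>" if "x \<in> S" for x
  proof
    assume "substring x \<omega>"
    then obtain m where "x = map \<omega> [m..<m + length x]"
      by (auto simp: substring_def)
    moreover have "map \<omega> [0..<m + length x] = map \<omega> [0..<m] @ map \<omega> [m..<m + length x]"
      by (metis le0 map_append upt_add_eq_append)
    ultimately have "sublist x (map \<omega> [0..<m + length x])"
      by (metis suffixI suffix_imp_sublist)
    with \<omega>[of "m + length x"] that show False
      by (auto simp: avoiding_def)
  qed
  then show ?thesis by blast
qed

theorem proposition1:
  fixes \<alpha> :: real and F :: "nat \<Rightarrow> bool list set"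
  assumes "0 < \<alpha>" and "\<alpha> < 1"
    and "\<And>n. F n \<subseteq> {x. length x = n}"
    and "\<And>n. real (card (F n)) \<le> 2 powr (\<alpha> * real n)"
  shows "\<exists>(\<omega> :: nat \<Rightarrow> bool) (N :: nat). \<forall>n>N.
           \<not> (\<exists>x. length x = n \<and> substring x \<omega> \<and> x \<in> F n)"
proof -
  \<comment> \<open>The hypothesis on \<open>F\<close> reads \<open>card (F n)\<close> \<le>
    \<open>q ^ n\<close>. A \<beta> strictly between \<open>q\<close> and 2 makes the ratio
    \<open>r\<close> less than 1 and leaves the slack 2 - \<beta> positive.\<close>
  define q where "q = (2 :: real) powr \<alpha>"
  have "q < 2"
    using assms(2) powr_less_mono[of \<alpha> 1 2] by (simp add: q_def)
  then obtain \<beta> where \<beta>: "q < \<beta>" "\<beta> < 2"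
    using dense by blast
  have "q > 0"
    by (simp add: q_def)
  with \<beta> have "\<beta> > 0" by simp
  define r where "r = q / \<beta>"
  have r: "0 < r" "r < 1"
    using \<beta> \<open>q > 0\<close> \<open>\<beta> > 0\<close> by (auto simp: r_def)
  \<comment> \<open>\<open>N\<close> is chosen so that \<beta> times the geometric tail from
    exponent \<open>Suc N\<close> on fits into this slack.\<close>
  have "0 < (2 - \<beta>) * (1 - r) / \<beta>"
    using \<beta> r \<open>\<beta> > 0\<close> by simp
  then obtain N where "r ^ N < (2 - \<beta>) * (1 - r) / \<beta>"
    using real_arch_pow_inv r by blast
  moreover have "r ^ Suc N \<le> r ^ N"
    using r by (intro power_decreasing) auto
  ultimately have "r ^ Suc N \<le> (2 - \<beta>) * (1 - r) / \<beta>"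
    by linarith
  then have N: "\<beta> * (r ^ Suc N / (1 - r)) \<le> 2 - \<beta>"
    using r \<open>\<beta> > 0\<close> by (simp add: field_simps)
  \<comment> \<open>Only lengths above \<open>N\<close> are forbidden, which also keeps the empty
    word out of \<open>S\<close>.\<close>
  define S where "S = (\<Union>k\<in>{N<..}. F k)"
  have S_len: "{x\<in>S. length x = k} = (if N < k then F k else {})" for k
    using assms(3) by (auto simp: S_def)
  have "[] \<notin> S"
    using assms(3) by (fastforce simp: S_def)
  moreover have "(\<Sum>k=1..n. real (card {x\<in>S. length x = k}) / \<beta> ^ (k - 1)) \<le> CARD(bool) - \<beta>" for n
  proof -
    have "(\<Sum>k=1..n. real (card {x\<in>S. length x = k}) / \<beta> ^ (k - 1))
        = (\<Sum>k\<in>{Suc N..n}. real (card (F k)) / \<beta> ^ (k - 1))"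
      by (intro sum.mono_neutral_cong_right) (auto simp: S_len)
    also have "\<dots> \<le> (\<Sum>k\<in>{Suc N..n}. \<beta> * r ^ k)"
    proof (rule sum_mono)
      fix k assume "k \<in> {Suc N..n}"
      \<comment> \<open>With \<beta> raised only to \<open>k - 1\<close>, the quotient
        \<open>q ^ k / \<beta> ^ (k - 1)\<close> is \<open>r ^ k\<close> with one factor \<beta>
        left over.\<close>
      then obtain j where k: "k = Suc j"
        by (cases k) auto
      have "real (card (F k)) \<le> q ^ k"
        using assms(4)[of k] by (simp add: q_def powr_powr flip: powr_realpow)
      then show "real (card (F k)) / \<beta> ^ (k - 1) \<le> \<beta> * r ^ k"
        using \<open>\<beta> > 0\<close> by (simp add: k r_def power_divide divide_right_mono)
    qed
    also have "\<dots> = \<beta> * (\<Sum>k\<in>{Suc N..n}. r ^ k)"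
      by (rule sum_distrib_left[symmetric])
    \<comment> \<open>The finite geometric sum is either empty or falls short of the full tail by a
      positive term.\<close>
    also have "\<dots> \<le> \<beta> * (r ^ Suc N / (1 - r))"
      using r \<open>\<beta> > 0\<close> by (intro mult_left_mono) (auto simp: sum_gp intro!: divide_right_mono)
    also have "\<dots> \<le> 2 - \<beta>"
      by (rule N)
    finally show ?thesis by simp
  qed
  ultimately obtain \<omega> where "\<forall>x\<in>S. \<not> substring x \<omega>"
    using ex_sequence_avoiding[of S \<beta>] \<open>\<beta> > 0\<close> by blast
  then show ?thesis
    by (auto simp: S_def)
qed

end
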